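(* Let $K$ be a number field with algebraic closure $\overline{K}$, let $b\in K$, $b\neq 0$, and let $\mathcal{E}$ be the elliptic curve over $K$ with Weierstrass equation $y^2=x^3+bx$. Let $i\in\overline{K}$ be a root of $x^2+1=0$, let $\zeta_5\in\overline{K}$ be a primitive $5$-th root of unity, and put $$\theta_1:=-\left((-4i+4)\zeta_5^3+4\zeta_5^2-4i\zeta_5-2i+5\right).$$ Then $$K_5=K\left(\zeta_5,\, i,\, \sqrt{(\theta_1+1)\,b\,\sqrt{\theta_1 b}}\right).$$
   Context: $\mathcal{E}[5]$ denotes the $5$-torsion subgroup of $\mathcal{E}(\overline{K})$, and $K_5:=K(\mathcal{E}[5])$ is the field obtained by adjoining to $K$ the coordinates of all the points of $\mathcal{E}[5]$. The symbols $\sqrt{\theta_1 b}$ and $\sqrt{(\theta_1+1)b\sqrt{\theta_1 b}}$ denote fixed square roots in $\overline{K}$, the same $\sqrt{\theta_1 b}$ being used inside the second one. *)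

theory Defs
  imports "HOL-Algebra.Generated_Fields" "HOL-Algebra.Algebraic_Closure_Type"
begin

text \<open>
  Throughout, the type \<open>'a\<close> plays the role of the algebraic closure of \<open>K\<close>, and \<open>K\<close> is a
  subset of it. The constant \<open>ring_of_type_algebra\<close> is the type \<open>'a\<close> viewed as a HOL-Algebra ring.
\<close>

definition number_field :: "'a::field_char_0 set \<Rightarrow> bool" where
  "number_field K \<longleftrightarrow>
     subfield K (ring_of_type_algebra :: 'a ring) \<and>
     ring.finite_dimension (ring_of_type_algebra :: 'a ring) \<rat> K"

definition adjoin :: "'a::field set \<Rightarrow> 'a set \<Rightarrow> 'a set" where
  "adjoin K S = generate_field ring_of_type_algebra (K \<union> S)"

definition primitive_root_of_unity :: "nat \<Rightarrow> 'a::field \<Rightarrow> bool" where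
  "primitive_root_of_unity n z \<longleftrightarrow> z ^ n = 1 \<and> (\<forall>k. 0 < k \<and> k < n \<longrightarrow> z ^ k \<noteq> 1)"

datatype 'a point = Infinity | Affine 'a 'a

text \<open>Points, with coordinates in \<open>'a\<close>, of the projective curve \<open>y\<^sup>2 = x\<^sup>3 + a x + c\<close>.\<close>

fun on_curve :: "'a::field \<Rightarrow> 'a \<Rightarrow> 'a point \<Rightarrow> bool" where
  "on_curve a c Infinity \<longleftrightarrow> True"
| "on_curve a c (Affine x y) \<longleftrightarrow> y ^ 2 = x ^ 3 + a * x + c"

text \<open>
  The chord and tangent law, in characteristic different from 2 and 3. For two points of the curve
  with \<open>x1 = x2\<close>, the second coordinates agree up to sign, so once the case \<open>y1 = - y2\<close> is excluded
  the points coincide and \<open>y1 \<noteq> 0\<close>.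
\<close>

fun ec_add :: "'a::field \<Rightarrow> 'a point \<Rightarrow> 'a point \<Rightarrow> 'a point" where
  "ec_add a Infinity Q = Q"
| "ec_add a P Infinity = P"
| "ec_add a (Affine x1 y1) (Affine x2 y2) =
     (if x1 = x2 \<and> y1 = - y2 then Infinity
      else let m = (if x1 = x2 then (3 * x1 ^ 2 + a) / (2 * y1) else (y2 - y1) / (x2 - x1));
               x3 = m ^ 2 - x1 - x2
           in Affine x3 (m * (x1 - x3) - y1))"

definition ec_mult :: "'a::field \<Rightarrow> nat \<Rightarrow> 'a point \<Rightarrow> 'a point" where
  "ec_mult a n P = (ec_add a P ^^ n) Infinity"

definition ec_torsion :: "'a::field \<Rightarrow> 'a \<Rightarrow> nat \<Rightarrow> 'a point set" where
  "ec_torsion a c n = {P. on_curve a c P \<and> ec_mult a n P = Infinity}"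

fun coordinates :: "'a point \<Rightarrow> 'a set" where
  "coordinates Infinity = {}"
| "coordinates (Affine x y) = {x, y}"

definition division_field :: "'a::field set \<Rightarrow> 'a \<Rightarrow> 'a \<Rightarrow> nat \<Rightarrow> 'a set" where
  "division_field K a c n = adjoin K (\<Union>P\<in>ec_torsion a c n. coordinates P)"

definition theta1 :: "'a::field \<Rightarrow> 'a \<Rightarrow> 'a" where
  "theta1 i z = - ((- 4 * i + 4) * z ^ 3 + 4 * z ^ 2 - 4 * i * z - 2 * i + 5)"

end

theory Submission
  imports Defs
begin

text \<open>
  The point \<open>P = (r, s)\<close> lies on the curve and is a 5-torsion point, because \<open>\<theta>\<^sub>1\<close> is a root of the
  quartic factor of the fifth division polynomial. The curve has complex multiplication by
  \<open>(x, y) \<mapsto> (-x, i y)\<close>, and the orbit of \<open>P\<close> under the ring generated by \<open>i\<close> is the whole 5-torsion, with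
  coordinates \<open>(u r, v s)\<close> for \<open>u\<close>, \<open>v\<close> in \<open>\<rat>(i, \<zeta>\<^sub>5)\<close>. Since \<open>r = s\<^sup>2 / ((\<theta>\<^sub>1 + 1) b)\<close>, this gives
  one inclusion. Conversely \<open>P\<close> and \<open>iP\<close> give \<open>s\<close> and \<open>i\<close>, and \<open>\<zeta>\<^sub>5\<close> is a rational polynomial in \<open>i\<close> and
  \<open>\<theta>\<^sub>1 = r\<^sup>2 / b\<close>.
\<close>

section \<open>Adjunction\<close>

lemma adjoin_closed:
  fixes K :: "'a::field_char_0 set"
  shows adjoin_0: "0 \<in> adjoin K S"
    and adjoin_1: "1 \<in> adjoin K S"
    and adjoin_base: "x \<in> K \<Longrightarrow> x \<in> adjoin K S"
    and adjoin_gen: "x \<in> S \<Longrightarrow> x \<in> adjoin K S"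
    and adjoin_add: "x \<in> adjoin K S \<Longrightarrow> y \<in> adjoin K S \<Longrightarrow> x + y \<in> adjoin K S"
    and adjoin_mult: "x \<in> adjoin K S \<Longrightarrow> y \<in> adjoin K S \<Longrightarrow> x * y \<in> adjoin K S"
    and adjoin_uminus: "x \<in> adjoin K S \<Longrightarrow> - x \<in> adjoin K S"
    and adjoin_diff: "x \<in> adjoin K S \<Longrightarrow> y \<in> adjoin K S \<Longrightarrow> x - y \<in> adjoin K S"
    and adjoin_divide: "x \<in> adjoin K S \<Longrightarrow> y \<in> adjoin K S \<Longrightarrow> x / y \<in> adjoin K S"
    and adjoin_power: "x \<in> adjoin K S \<Longrightarrow> x ^ n \<in> adjoin K S"
    and adjoin_numeral: "numeral k \<in> adjoin K S"
proof -
  let ?R = "ring_of_type_algebra :: 'a ring"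
  interpret R: Ring.field ?R by (rule field_from_type_algebra)
  have R [simp]: "carrier ?R = UNIV" "\<zero>\<^bsub>?R\<^esub> = 0" "\<one>\<^bsub>?R\<^esub> = 1"
    "x \<oplus>\<^bsub>?R\<^esub> y = x + y" "x \<otimes>\<^bsub>?R\<^esub> y = x * y" for x y
    by (simp_all add: ring_of_type_algebra_def)
  have uminus_R [simp]: "\<ominus>\<^bsub>?R\<^esub> x = - x" for x
    using R.minus_equality[of "- x" x] by simp
  have inv_R: "inv\<^bsub>?R\<^esub> x = inverse x" if "x \<noteq> 0" for x
    using R.comm_inv_char[of x "inverse x"] that by simp
  have sf: "subfield (adjoin K S) ?R"
    unfolding adjoin_def by (rule R.generate_field_is_subfield) simp
  note sr = subfieldE(1)[OF sf]
  show 0: "0 \<in> adjoin K S" using subringE(2)[OF sr] by simp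
  show 1: "1 \<in> adjoin K S" using subringE(3)[OF sr] by simp
  show "x \<in> K \<Longrightarrow> x \<in> adjoin K S" "x \<in> S \<Longrightarrow> x \<in> adjoin K S" for x
    unfolding adjoin_def by (auto intro: generate_field.incl)
  show add: "x \<in> adjoin K S \<Longrightarrow> y \<in> adjoin K S \<Longrightarrow> x + y \<in> adjoin K S" for x y
    using subringE(7)[OF sr, of x y] by simp
  show mult: "x \<in> adjoin K S \<Longrightarrow> y \<in> adjoin K S \<Longrightarrow> x * y \<in> adjoin K S" for x y
    using subringE(6)[OF sr, of x y] by simp
  show um: "x \<in> adjoin K S \<Longrightarrow> - x \<in> adjoin K S" for x
    using subringE(5)[OF sr, of x] by simp
  show "x \<in> adjoin K S \<Longrightarrow> y \<in> adjoin K S \<Longrightarrow> x - y \<in> adjoin K S" for x y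
    using add[of x "- y"] um[of y] by simp
  \<comment> \<open>At 0 the convention \<open>inverse 0 = 0\<close> of the type applies; the ring
    inverse is only compared with \<open>inverse\<close> away from 0.\<close>
  have inv: "inverse x \<in> adjoin K S" if "x \<in> adjoin K S" for x
  proof (cases "x = 0")
    case False
    then show ?thesis
      using R.subfield_m_inv(1)[OF sf, of x] that by (simp add: inv_R)
  qed (simp add: 0)
  show "x \<in> adjoin K S \<Longrightarrow> y \<in> adjoin K S \<Longrightarrow> x / y \<in> adjoin K S" for x y
    using mult[of x "inverse y"] inv[of y] by (simp add: divide_inverse)
  show "x \<in> adjoin K S \<Longrightarrow> x ^ n \<in> adjoin K S" for x n
    by (induction n) (auto intro: 1 mult)
  have "of_nat n \<in> adjoin K S" for n
    by (induction n) (auto intro: 0 1 add)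
  from this[of "numeral k"] show "numeral k \<in> adjoin K S" by simp
qed

lemma adjoin_subset:
  fixes K :: "'a::field_char_0 set"
  assumes "S \<subseteq> adjoin K T"
  shows "adjoin K S \<subseteq> adjoin K T"
proof -
  let ?R = "ring_of_type_algebra :: 'a ring"
  interpret R: Ring.field ?R by (rule field_from_type_algebra)
  have c: "carrier ?R = UNIV" by (simp add: ring_of_type_algebra_def)
  have sf: "subfield (adjoin K T) ?R"
    unfolding adjoin_def by (rule R.generate_field_is_subfield) (simp add: c)
  have "K \<union> S \<subseteq> adjoin K T" using assms by (auto intro: adjoin_base)
  then show ?thesis
    using R.generate_field_min_subfield1[OF _ sf, of "K \<union> S"] unfolding adjoin_def by (simp add: c)
qed

section \<open>Chords and tangents\<close>

text \<open>
  HOL-Algebra shadows the Groebner basis method with one of its own, hence the qualified name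
  \<open>Groebner_Basis.algebra\<close> from here on.
\<close>

lemma ec_add_comm: "ec_add a P Q = ec_add a Q P" if "on_curve a c P" "on_curve a c Q"
proof (cases P; cases Q)
  fix x y x' y' assume PQ: "P = Affine x y" "Q = Affine x' y'"
  show ?thesis
  proof (cases "x = x'")
    case True
    then have "y ^ 2 = y' ^ 2" using that PQ by simp
    then show ?thesis using True PQ by (auto simp: power2_eq_iff Let_def)
  next
    case False
    define m where "m = (y' - y) / (x' - x)"
    have m: "m * (x' - x) = y' - y" "(y - y') / (x - x') = m"
      using False by (simp_all add: m_def divide_simps algebra_simps)
    have "m * (x' - (m ^ 2 - x' - x)) - y' = m * (x - (m ^ 2 - x - x')) - y"
      using m(1) by Groebner_Basis.algebra
    then show ?thesis
      using False m(2) by (simp add: PQ Let_def flip: m_def)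
  qed
qed simp_all

lemma on_curve_ec_add:
  fixes a :: "'a::field_char_0"
  assumes "on_curve a c P" "on_curve a c Q"
  shows "on_curve a c (ec_add a P Q)"
proof (cases P; cases Q)
  fix x y x' y' assume PQ: "P = Affine x y" "Q = Affine x' y'"
  have c: "y ^ 2 = x ^ 3 + a * x + c" "y' ^ 2 = x' ^ 3 + a * x' + c" using assms PQ by auto
  show ?thesis
  proof (cases "x = x'")
    case True
    show ?thesis
    proof (cases "y = - y'")
      case False
      have "y ^ 2 = y' ^ 2" using c True by simp
      with False have y: "y = y'" by (auto simp: power2_eq_iff)
      with False have "y' \<noteq> 0" by auto
      define m where "m = (3 * x' ^ 2 + a) / (2 * y')"
      have m: "2 * y' * m = 3 * x' ^ 2 + a" using \<open>y' \<noteq> 0\<close> by (simp add: m_def)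
      have "(m * (x' - (m ^ 2 - x' - x')) - y') ^ 2
        = (m ^ 2 - x' - x') ^ 3 + a * (m ^ 2 - x' - x') + c"
        using m c(2) by Groebner_Basis.algebra
      then show ?thesis
        using True y False by (simp add: PQ Let_def flip: m_def)
    qed (simp add: True PQ)
  next
    case False
    define m where "m = (y' - y) / (x' - x)"
    have m: "m * (x' - x) = y' - y" using False by (simp add: m_def)
    \<comment> \<open>Difference of the two curve equations, with \<open>y'\<close> replaced using
      the slope. The common factor \<open>x' - x\<close> must be cancelled before the third
      intersection point can be handled.\<close>
    have "(x' - x) * (m ^ 2 * (x' - x) + 2 * m * y) = (x' - x) * (x' ^ 2 + x' * x + x ^ 2 + a)"
      using m c by Groebner_Basis.algebra
    then have "m ^ 2 * (x' - x) + 2 * m * y = x' ^ 2 + x' * x + x ^ 2 + a"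
      using False by simp
    then have "(m * (x - (m ^ 2 - x - x')) - y) ^ 2
      = (m ^ 2 - x - x') ^ 3 + a * (m ^ 2 - x - x') + c"
      using c(1) by Groebner_Basis.algebra
    then show ?thesis
      using False by (simp add: PQ Let_def flip: m_def)
  qed
qed (use assms in simp_all)

lemma ec_add_eq_Infinity_iff:
  "ec_add a (Affine x y) Q = Infinity \<longleftrightarrow> Q = Affine x (- y)"
  by (cases Q) (auto simp: Let_def)

lemma ec_add_self:
  fixes a :: "'a::field_char_0"
  assumes "2 * y * m = 3 * x ^ 2 + a" "y \<noteq> 0"
  shows "ec_add a (Affine x y) (Affine x y) = Affine (m ^ 2 - 2 * x) (m * (x - (m ^ 2 - 2 * x)) - y)"
proof -
  have "(3 * x ^ 2 + a) / (2 * y) = m" using assms by (simp add: field_simps)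
  moreover have "y \<noteq> - y" using assms by simp
  ultimately show ?thesis by (simp add: Let_def)
qed

text \<open>If P + Q = -P, the line PQ meets the curve a second time at P, so it is the tangent
  there. The division-free form also covers Q = P, where both sides vanish.\<close>

lemma tangent_of_ec_add_eq_uminus:
  fixes a :: "'a::field_char_0"
  assumes "on_curve a c (Affine x y)" "on_curve a c (Affine x' y')"
    and "ec_add a (Affine x y) (Affine x' y') = Affine x (- y)"
  shows "2 * y * (y' - y) = (3 * x ^ 2 + a) * (x' - x)"
proof (cases "x' = x")
  case True
  have "y' ^ 2 = y ^ 2" using assms True by simp
  then have "y' = y" using assms True by (auto simp: power2_eq_iff)
  then show ?thesis using True by simp
next
  case False
  have c: "y ^ 2 = x ^ 3 + a * x + c" "y' ^ 2 = x' ^ 3 + a * x' + c" using assms by auto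
  define m where "m = (y' - y) / (x' - x)"
  have m: "m * (x' - x) = y' - y" using False by (simp add: m_def)
  have x'_eq: "m ^ 2 - x - x' = x"
    using assms(3) False by (simp add: Let_def flip: m_def)
  have "(x' - x) * (2 * y * (y' - y)) = (x' - x) * ((3 * x ^ 2 + a) * (x' - x))"
    using m c x'_eq by Groebner_Basis.algebra
  then show ?thesis using False by simp
qed

lemma ec_add_eq_uminus_of_tangent:
  fixes a :: "'a::field_char_0"
  assumes "on_curve a c (Affine x y)" "on_curve a c (Affine x' y')" "x' \<noteq> x"
    and "2 * y * (y' - y) = (3 * x ^ 2 + a) * (x' - x)"
  shows "ec_add a (Affine x y) (Affine x' y') = Affine x (- y)"
proof -
  have c: "y ^ 2 = x ^ 3 + a * x + c" "y' ^ 2 = x' ^ 3 + a * x' + c" using assms by auto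
  define m where "m = (y' - y) / (x' - x)"
  have m: "m * (x' - x) = y' - y" using assms by (simp add: m_def)
  \<comment> \<open>The three abscissae on the line sum to \<open>m ^ 2\<close>, and tangency makes
    \<open>x\<close> a double one. The factor clears the denominator of
    \<open>m ^ 2\<close>.\<close>
  have "(x' - x) * (x' - x) * (m ^ 2 - x - x') = (x' - x) * (x' - x) * x"
    using m c assms(4) by Groebner_Basis.algebra
  then have third: "m ^ 2 - x - x' = x" using assms(3) by simp
  have "ec_add a (Affine x y) (Affine x' y')
    = Affine (m ^ 2 - x - x') (m * (x - (m ^ 2 - x - x')) - y)"
    using assms(3) by (simp add: Let_def flip: m_def)
  then show ?thesis by (simp only: third) simp
qed

text \<open>An instance of associativity, P + Q = -P implying 2P = -Q, read off geometrically: the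
  line PQ is the tangent at P, so its remaining intersection point is Q.\<close>

lemma ec_add_self_of_eq_uminus:
  fixes a :: "'a::field_char_0"
  assumes "on_curve a c (Affine x y)" "on_curve a c (Affine x' y')" "y \<noteq> 0"
    and add: "ec_add a (Affine x y) (Affine x' y') = Affine x (- y)"
  shows "ec_add a (Affine x y) (Affine x y) = Affine x' (- y')"
proof (cases "x' = x")
  case True
  have "y' ^ 2 = y ^ 2" using assms True by simp
  then have "y' = y" using add True by (auto simp: power2_eq_iff)
  then show ?thesis using True add by simp
next
  case False
  define m where "m = (y' - y) / (x' - x)"
  have m: "m * (x' - x) = y' - y" using False by (simp add: m_def)
  have x'_eq: "m ^ 2 - 2 * x = x'"
    using add False by (simp add: Let_def algebra_simps flip: m_def)
  have "(x' - x) * (2 * y * m) = (x' - x) * (3 * x ^ 2 + a)"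
    using tangent_of_ec_add_eq_uminus[OF assms(1,2) add] m by Groebner_Basis.algebra
  then have t: "2 * y * m = 3 * x ^ 2 + a" using False by simp
  have "m * (x - x') - y = - y'" using m by Groebner_Basis.algebra
  then show ?thesis using ec_add_self[OF t \<open>y \<noteq> 0\<close>] x'_eq by simp
qed


section \<open>Points of order five\<close>

lemma ec_mult_5: "ec_mult a 5 P = ec_add a P (ec_add a P (ec_add a P (ec_add a P P)))"
proof -
  have "ec_add a P Infinity = P" by (cases P) simp_all
  then show ?thesis by (simp add: ec_mult_def numeral_eq_Suc)
qed

text \<open>The fifth division polynomial of \<open>y^2 = x^3 + b x\<close> is this quartic at
  \<open>t = x^2\<close> times \<open>5 t^2 + 2 b t + b^2\<close>.\<close>

definition psi5_quartic :: "'a::field \<Rightarrow> 'a \<Rightarrow> 'a" where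
  "psi5_quartic b t = t ^ 4 + 12 * b * t ^ 3 - 26 * b ^ 2 * t ^ 2 - 52 * b ^ 3 * t + b ^ 4"

text \<open>
  The bracket on the left vanishes iff \<open>P = (x, y)\<close> lies on the tangent at \<open>2P = (x', y')\<close>, that is,
  \<open>P + 2P = -2P\<close> (when \<open>x \<noteq> x'\<close>).
\<close>

lemma double_point_tangent_psi5:
  fixes b :: "'a::field_char_0"
  assumes y: "y ^ 2 = x ^ 3 + b * x" and m: "2 * y * m = 3 * x ^ 2 + b"
    and X: "x' = m ^ 2 - 2 * x" and Y: "y' = m * (x - x') - y"
  shows "64 * y ^ 6 * (2 * y' * (y - y') - (3 * x' ^ 2 + b) * (x - x'))
    = (5 * x ^ 4 + 2 * b * x ^ 2 + b ^ 2) * psi5_quartic b (x ^ 2)"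
proof -
  \<comment> \<open>Scaling \<open>x'\<close> by \<open>4 y^2\<close> and \<open>y'\<close> by
    \<open>8 y^3\<close> turns the coordinates of 2P into polynomials in \<open>x\<close> and
    \<open>b\<close>; the factor \<open>64 y^6\<close> does this for the whole bracket.\<close>
  define A where "A = 8 * y ^ 3 * y'"
  define B where "B = 4 * y ^ 2 * x'"
  define D where "D = 4 * y ^ 2"
  have D: "D = 4 * (x ^ 3 + b * x)" using y by (simp add: D_def)
  have "B = (2 * y * m) ^ 2 - 2 * x * D" unfolding B_def D_def X by Groebner_Basis.algebra
  then have B: "B = (x ^ 2 - b) ^ 2" unfolding m D by Groebner_Basis.algebra
  have "2 * A = (2 * y * m) * 2 * (x * D - B) - D ^ 2"
    unfolding A_def B_def D_def Y by Groebner_Basis.algebra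
  then have "2 * A = 2 * ((x ^ 2 - b) * (x ^ 4 + 6 * b * x ^ 2 + b ^ 2))"
    unfolding m B D by Groebner_Basis.algebra
  then have A: "A = (x ^ 2 - b) * (x ^ 4 + 6 * b * x ^ 2 + b ^ 2)" by simp
  have "64 * y ^ 6 * (2 * y' * (y - y') - (3 * x' ^ 2 + b) * (x - x'))
    = A * (D ^ 2 - 2 * A) - (3 * B ^ 2 + b * D ^ 2) * (x * D - B)"
    unfolding A_def B_def D_def by Groebner_Basis.algebra
  also have "\<dots> = (5 * x ^ 4 + 2 * b * x ^ 2 + b ^ 2) * psi5_quartic b (x ^ 2)"
    unfolding A B D psi5_quartic_def by Groebner_Basis.algebra
  finally show ?thesis .
qed

text \<open>From P + 3P = -P follows 2P = -3P. Hence 2P + P = -2P, so P lies on the tangent at 2P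
  and the bracket of \<open>double_point_tangent_psi5\<close> vanishes.\<close>

lemma psi5_eq_0_of_torsion:
  fixes b :: "'a::field_char_0"
  assumes P: "on_curve b 0 (Affine x y)" and T5: "ec_mult b 5 (Affine x y) = Infinity"
  shows "(5 * x ^ 4 + 2 * b * x ^ 2 + b ^ 2) * psi5_quartic b (x ^ 2) = 0"
proof -
  let ?P = "Affine x y"
  define P2 where "P2 = ec_add b ?P ?P"
  define P3 where "P3 = ec_add b ?P P2"
  have P4: "ec_add b ?P P3 = Affine x (- y)"
    using T5 by (simp add: ec_mult_5 P2_def P3_def ec_add_eq_Infinity_iff del: ec_add.simps)
  have "y \<noteq> 0"
  proof
    assume "y = 0"
    then show False using P4 by (simp add: P2_def P3_def)
  qed
  have "P3 \<noteq> Infinity" using P4 \<open>y \<noteq> 0\<close> by auto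
  then obtain x' w where P3: "P3 = Affine x' w" by (cases P3) auto
  have curve: "on_curve b 0 P2" "on_curve b 0 P3"
    using P by (auto simp: P2_def P3_def intro!: on_curve_ec_add simp del: ec_add.simps on_curve.simps)
  have P2: "P2 = Affine x' (- w)"
    using ec_add_self_of_eq_uminus[OF P _ \<open>y \<noteq> 0\<close>, of x' w] P4 P3 curve
    by (simp add: P2_def del: ec_add.simps on_curve.simps)
  have "ec_add b P2 ?P = Affine x' w"
    using ec_add_comm[OF curve(1) P] P3 by (simp add: P3_def)
  then have tan: "2 * (- w) * (y - - w) = (3 * x' ^ 2 + b) * (x - x')"
    using tangent_of_ec_add_eq_uminus[of b 0 x' "- w" x y] P curve(1) by (simp add: P2)
  define m where "m = (3 * x ^ 2 + b) / (2 * y)"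
  have m: "2 * y * m = 3 * x ^ 2 + b" using \<open>y \<noteq> 0\<close> by (simp add: m_def)
  have "x' = m ^ 2 - 2 * x" "- w = m * (x - x') - y"
    using ec_add_self[OF m \<open>y \<noteq> 0\<close>] P2 by (auto simp: P2_def)
  from double_point_tangent_psi5[OF _ m this] tan P show ?thesis by simp
qed

text \<open>The tangent argument run backwards: P lies on the tangent at 2P, so 3P = -2P. The chord
  from P to -2P is the tangent at P, so P + 3P = -P.\<close>

lemma torsion_of_psi5_quartic:
  fixes b :: "'a::field_char_0"
  assumes P: "on_curve b 0 (Affine x y)" and q: "psi5_quartic b (x ^ 2) = 0" and "b \<noteq> 0"
  shows "ec_mult b 5 (Affine x y) = Infinity"
proof -
  have y: "y ^ 2 = x ^ 3 + b * x" using P by simp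
  have "y \<noteq> 0"
  proof
    assume "y = 0"
    then have "x * (x ^ 2 + b) = 0" using y by Groebner_Basis.algebra
    then consider "x = 0" | "x ^ 2 = - b" by (auto simp: eq_neg_iff_add_eq_0)
    then show False using q \<open>b \<noteq> 0\<close> by cases (auto simp: psi5_quartic_def power_def)
  qed
  define m where "m = (3 * x ^ 2 + b) / (2 * y)"
  define x' where "x' = m ^ 2 - 2 * x"
  define y' where "y' = m * (x - x') - y"
  have m: "2 * y * m = 3 * x ^ 2 + b" using \<open>y \<noteq> 0\<close> by (simp add: m_def)
  have P2: "ec_add b (Affine x y) (Affine x y) = Affine x' y'"
    using ec_add_self[OF m \<open>y \<noteq> 0\<close>] by (simp add: x'_def y'_def)
  then have curve: "on_curve b 0 (Affine x' y')" using on_curve_ec_add[OF P P] by simp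
  have tan: "2 * y' * (y - y') = (3 * x' ^ 2 + b) * (x - x')"
    using double_point_tangent_psi5[OF y m x'_def y'_def] q \<open>y \<noteq> 0\<close> by simp
  \<comment> \<open>Equality would give 3P = O, so \<open>x\<close> would be a root of the third
    division polynomial \<open>3 x^4 + 6 b x^2 - b^2\<close>. Reducing the quartic modulo it leaves
    a multiple of \<open>b^3 (3 x^2 - b)\<close>, which forces \<open>b = 0\<close>.\<close>
  have "x' \<noteq> x"
  proof
    assume "x' = x"
    then have "m ^ 2 = 3 * x" by (simp add: x'_def algebra_simps)
    then have "3 * (x ^ 2) ^ 2 + 6 * b * x ^ 2 - b ^ 2 = 0"
      using m y by Groebner_Basis.algebra
    moreover from this have "b ^ 3 * (3 * x ^ 2) = b ^ 3 * b"
      using q unfolding psi5_quartic_def by Groebner_Basis.algebra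
    then have "3 * x ^ 2 = b" using \<open>b \<noteq> 0\<close> by simp
    ultimately have "b ^ 2 = 0" by Groebner_Basis.algebra
    then show False using \<open>b \<noteq> 0\<close> by simp
  qed
  have "ec_add b (Affine x' y') (Affine x y) = Affine x' (- y')"
    using ec_add_eq_uminus_of_tangent[OF curve P] tan \<open>x' \<noteq> x\<close> by auto
  then have P3: "ec_add b (Affine x y) (Affine x' y') = Affine x' (- y')"
    using ec_add_comm[OF curve P] by simp
  have "ec_add b (Affine x y) (Affine x' (- y')) = Affine x (- y)"
  proof (rule ec_add_eq_uminus_of_tangent[OF P _ \<open>x' \<noteq> x\<close>])
    show "on_curve b 0 (Affine x' (- y'))" using curve by simp
    show "2 * y * (- y' - y) = (3 * x ^ 2 + b) * (x' - x)"
      unfolding y'_def m[symmetric] by (simp add: algebra_simps)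
  qed
  then show ?thesis
    by (simp add: ec_mult_5 P2 P3 ec_add_eq_Infinity_iff del: ec_add.simps)
qed


section \<open>The division field\<close>

text \<open>The roots are \<open>theta1 i \<zeta> * b\<close> and its conjugates under \<zeta> ->
  \<zeta>^k over Q(i), listed for k = 1, 4, 2, 3.\<close>

lemma psi5_quartic_factor:
  fixes i \<zeta> :: "'a::field_char_0"
  assumes "i ^ 2 + 1 = 0" and "\<zeta> ^ 4 + \<zeta> ^ 3 + \<zeta> ^ 2 + \<zeta> + 1 = 0"
  shows "psi5_quartic b t =
      (t - (-5 - 4 * \<zeta> ^ 2 - 4 * \<zeta> ^ 3 + 2 * i + 4 * i * \<zeta> + 4 * i * \<zeta> ^ 3) * b) *
      (t - (-5 - 4 * \<zeta> ^ 2 - 4 * \<zeta> ^ 3 - 2 * i - 4 * i * \<zeta> - 4 * i * \<zeta> ^ 3) * b) *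
      (t - (-1 + 4 * \<zeta> ^ 2 + 4 * \<zeta> ^ 3 + 2 * i + 4 * i * \<zeta> + 4 * i * \<zeta> ^ 2) * b) *
      (t - (-1 + 4 * \<zeta> ^ 2 + 4 * \<zeta> ^ 3 - 2 * i - 4 * i * \<zeta> - 4 * i * \<zeta> ^ 2) * b)"
  using assms unfolding psi5_quartic_def by Groebner_Basis.algebra

lemma psi5_quartic_theta1:
  fixes i \<zeta> :: "'a::field_char_0"
  assumes "i ^ 2 + 1 = 0" and "\<zeta> ^ 4 + \<zeta> ^ 3 + \<zeta> ^ 2 + \<zeta> + 1 = 0"
  shows "psi5_quartic b (theta1 i \<zeta> * b) = 0"
  using assms unfolding psi5_quartic_def theta1_def by Groebner_Basis.algebra

text \<open>The four conjugates of \<open>th\<close> over Q(i) are distinct, so \<open>th\<close>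
  generates Q(i, \<zeta>) over Q(i); this is \<zeta> in the basis of powers of
  \<open>th\<close>.\<close>

lemma zeta_eq_theta1:
  fixes i \<zeta> :: "'a::field_char_0"
  assumes "i ^ 2 + 1 = 0" and "\<zeta> ^ 4 + \<zeta> ^ 3 + \<zeta> ^ 2 + \<zeta> + 1 = 0"
    and "th = theta1 i \<zeta>"
  shows "\<zeta> = (19 + 41 * th - 11 * th ^ 2 - th ^ 3
    + i * (60 + 46 * th - 24 * th ^ 2 - 2 * th ^ 3)) / 64"
proof -
  have "\<zeta> * 64 = 19 + 41 * th - 11 * th ^ 2 - th ^ 3
    + i * (60 + 46 * th - 24 * th ^ 2 - 2 * th ^ 3)"
    using assms(1,2) unfolding assms(3) theta1_def by Groebner_Basis.algebra
  then show ?thesis by simp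
qed

text \<open>
  Let \<open>P = (r, s)\<close> with \<open>r\<^sup>2 = \<theta>\<^sub>1 b\<close> and \<open>s\<^sup>2 = (\<theta>\<^sub>1 + 1) b r\<close>. The pairs \<open>(u, v)\<close> below are those for
  which the points \<open>P\<close>, \<open>2P\<close>, \<open>(1 + i)P\<close>, \<open>2(1 + i)P\<close>, \<open>(2 + i)P\<close> and \<open>(2 - i)P\<close> are \<open>(u r, v s)\<close>,
  where \<open>i\<close> acts by \<open>(x, y) \<mapsto> (-x, i y)\<close>. Every point of order 5 is one of these up to the
  action of \<open>\<plusminus>1\<close> and \<open>\<plusminus>i\<close>.
\<close>

definition torsion_scalings :: "'a::field_char_0 \<Rightarrow> 'a \<Rightarrow> ('a \<times> 'a) set" where
  "torsion_scalings i \<zeta> = {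
    (1,
     1),
    (3 - 2 * \<zeta> ^ 2 - 2 * \<zeta> ^ 3 - 2 * i - 4 * i * \<zeta> - 4 * i * \<zeta> ^ 2,
     -5 - \<zeta> ^ 2 - \<zeta> ^ 3 + 3 * i * \<zeta> ^ 2 - 3 * i * \<zeta> ^ 3),
    (-5 - 10 * \<zeta> - 8 * \<zeta> ^ 2 - 2 * \<zeta> ^ 3 - 4 * i + 6 * i * \<zeta> ^ 2 + 6 * i * \<zeta> ^ 3,
     4 + 5 * \<zeta> + \<zeta> ^ 2 - 2 * \<zeta> ^ 3 - i - 5 * i * \<zeta> - 7 * i * \<zeta> ^ 2 - 4 * i * \<zeta> ^ 3),
    (-1 - 2 * \<zeta> - 2 * \<zeta> ^ 2 - 2 * i + 2 * i * \<zeta> ^ 2 + 2 * i * \<zeta> ^ 3,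
     1 - \<zeta> - \<zeta> ^ 3 + 2 * i + i * \<zeta> + i * \<zeta> ^ 3),
    ((5 + 8 * \<zeta> + 4 * \<zeta> ^ 2 - 2 * \<zeta> ^ 3 - 6 * i * \<zeta> - 8 * i * \<zeta> ^ 2 - 6 * i * \<zeta> ^ 3) / 5,
     (5 + 3 * \<zeta> + 2 * \<zeta> ^ 2 - i * \<zeta> - 4 * i * \<zeta> ^ 2) / 5),
    ((-3 - 8 * \<zeta> - 10 * \<zeta> ^ 2 - 4 * \<zeta> ^ 3 - 6 * i - 6 * i * \<zeta> + 2 * i * \<zeta> ^ 3) / 5,
     (2 - 3 * \<zeta> - 3 * \<zeta> ^ 2 - \<zeta> ^ 3 - i - i * \<zeta> - i * \<zeta> ^ 2 + 3 * i * \<zeta> ^ 3) / 5)}"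

lemma torsion_scalings_closed:
  assumes "(u, v) \<in> torsion_scalings i \<zeta>" and "i \<in> adjoin K S" "\<zeta> \<in> adjoin K S"
  shows "u \<in> adjoin K S" "v \<in> adjoin K S"
proof -
  have "\<forall>(u, v) \<in> torsion_scalings i \<zeta>. u \<in> adjoin K S \<and> v \<in> adjoin K S"
    unfolding torsion_scalings_def
    by (simp only: ball_simps prod.case, intro conjI TrueI adjoin_closed(1,2,5-) assms(2,3))
  then show "u \<in> adjoin K S" "v \<in> adjoin K S" using assms(1) by auto
qed

text \<open>This is the curve equation at \<open>(u r, v s)\<close>, divided by
  \<open>b r\<close>.\<close>

lemma torsion_scalings_curve:
  fixes i \<zeta> :: "'a::field_char_0"
  assumes "(u, v) \<in> torsion_scalings i \<zeta>"
    and i: "i ^ 2 + 1 = 0" and z: "\<zeta> ^ 4 + \<zeta> ^ 3 + \<zeta> ^ 2 + \<zeta> + 1 = 0"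
  shows "v ^ 2 * (theta1 i \<zeta> + 1) = u * (u ^ 2 * theta1 i \<zeta> + 1)"
proof -
  have "\<forall>(u, v) \<in> torsion_scalings i \<zeta>.
    v ^ 2 * (theta1 i \<zeta> + 1) = u * (u ^ 2 * theta1 i \<zeta> + 1)"
    unfolding torsion_scalings_def theta1_def
    by (simp only: ball_simps prod.case power_one mult_1, intro conjI TrueI refl)
      ((use i z in Groebner_Basis.algebra)+)
  then show ?thesis using assms(1) by auto
qed

text \<open>The values of \<open>x^2 / b\<close> at the six points: the four roots of the quartic
  for \<open>b = 1\<close>, then the two roots of \<open>5 t^2 + 2 t + 1\<close>. They follow the
  order of \<open>torsion_scalings\<close>, so the proof can match them entry by entry.\<close>

lemma torsion_scalings_abscissae:
  fixes i \<zeta> :: "'a::field_char_0"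
  assumes i: "i ^ 2 + 1 = 0" and z: "\<zeta> ^ 4 + \<zeta> ^ 3 + \<zeta> ^ 2 + \<zeta> + 1 = 0"
  shows "(\<lambda>(u, v). u ^ 2 * theta1 i \<zeta>) ` torsion_scalings i \<zeta> = {
    -5 - 4 * \<zeta> ^ 2 - 4 * \<zeta> ^ 3 + 2 * i + 4 * i * \<zeta> + 4 * i * \<zeta> ^ 3,
    -5 - 4 * \<zeta> ^ 2 - 4 * \<zeta> ^ 3 - 2 * i - 4 * i * \<zeta> - 4 * i * \<zeta> ^ 3,
    -1 + 4 * \<zeta> ^ 2 + 4 * \<zeta> ^ 3 + 2 * i + 4 * i * \<zeta> + 4 * i * \<zeta> ^ 2,
    -1 + 4 * \<zeta> ^ 2 + 4 * \<zeta> ^ 3 - 2 * i - 4 * i * \<zeta> - 4 * i * \<zeta> ^ 2,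
    (-1 + 2 * i) / 5,
    (-1 - 2 * i) / 5}"
  unfolding torsion_scalings_def theta1_def image_insert image_empty prod.case power_one mult_1
  by (intro arg_cong2[where f = insert] refl)
    (simp add: algebra_simps, (use i z in Groebner_Basis.algebra)+)

lemma psi5_root_torsion_scalings:
  fixes i \<zeta> b :: "'a::field_char_0"
  assumes i: "i ^ 2 + 1 = 0" and z: "\<zeta> ^ 4 + \<zeta> ^ 3 + \<zeta> ^ 2 + \<zeta> + 1 = 0"
    and psi: "(5 * x ^ 4 + 2 * b * x ^ 2 + b ^ 2) * psi5_quartic b (x ^ 2) = 0"
  obtains u v where "(u, v) \<in> torsion_scalings i \<zeta>" "x ^ 2 = u ^ 2 * (theta1 i \<zeta> * b)"
proof -
  have "5 * x ^ 4 + 2 * b * x ^ 2 + b ^ 2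
    = 5 * ((x ^ 2 - ((-1 + 2 * i) / 5) * b) * (x ^ 2 - ((-1 - 2 * i) / 5) * b))"
    using i by Groebner_Basis.algebra
  then have "\<exists>c \<in> (\<lambda>(u, v). u ^ 2 * theta1 i \<zeta>) ` torsion_scalings i \<zeta>. x ^ 2 = c * b"
    using psi unfolding psi5_quartic_factor[OF i z] torsion_scalings_abscissae[OF i z]
    by (simp only: bex_simps mult_eq_0_iff right_minus_eq) auto
  then show ?thesis using that by (force simp: mult.assoc)
qed

text \<open>The division polynomial gives only \<open>x^2\<close>, hence \<open>x\<close> up to
  sign. Changing that sign negates \<open>y^2\<close>, which is where the factor \<open>i\<close> in
  \<open>y\<close> comes from.\<close>

lemma torsion_coordinates:
  fixes b :: "'a::field_char_0"
  assumes i: "i ^ 2 + 1 = 0" and z: "\<zeta> ^ 4 + \<zeta> ^ 3 + \<zeta> ^ 2 + \<zeta> + 1 = 0"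
    and r: "r ^ 2 = theta1 i \<zeta> * b" and s: "s ^ 2 = (theta1 i \<zeta> + 1) * b * r"
    and P: "on_curve b 0 (Affine x y)" and T5: "ec_mult b 5 (Affine x y) = Infinity"
  obtains u v where "(u, v) \<in> torsion_scalings i \<zeta>" "x \<in> {u * r, - (u * r)}"
    "y \<in> {v * s, - (v * s), i * v * s, - (i * v * s)}"
proof -
  obtain u v where uv: "(u, v) \<in> torsion_scalings i \<zeta>" and x2: "x ^ 2 = u ^ 2 * (theta1 i \<zeta> * b)"
    using psi5_root_torsion_scalings[OF i z psi5_eq_0_of_torsion[OF P T5]] .
  have v: "v ^ 2 * (theta1 i \<zeta> + 1) = u * (u ^ 2 * theta1 i \<zeta> + 1)"
    by (rule torsion_scalings_curve[OF uv i z])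
  have "x ^ 2 = (u * r) ^ 2" using x2 r by Groebner_Basis.algebra
  then have x: "x \<in> {u * r, - (u * r)}" by (auto simp: power2_eq_iff)
  have y: "y ^ 2 = x * (u ^ 2 * theta1 i \<zeta> + 1) * b"
    using P x2 by (simp add: power3_eq_cube power2_eq_square algebra_simps)
  from x consider "x = u * r" | "x = - (u * r)" by auto
  then have "y \<in> {v * s, - (v * s), i * v * s, - (i * v * s)}"
  proof cases
    case 1
    have "y ^ 2 = (v * s) ^ 2" using y v s 1 by Groebner_Basis.algebra
    then show ?thesis by (auto simp: power2_eq_iff)
  next
    case 2
    have "y ^ 2 = (i * v * s) ^ 2" using y v s i 2 by Groebner_Basis.algebra
    then show ?thesis by (auto simp: power2_eq_iff)
  qed
  with uv x show ?thesis by (rule that)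
qed

theorem theorem2p2:
  fixes K :: "'a::field_char_0 set" and b i \<zeta> r s :: 'a
  assumes "number_field K"
    and "algebraic_closure (ring_of_type_algebra :: 'a ring) K"
    and "b \<in> K" and "b \<noteq> 0"
    and "i ^ 2 + 1 = 0"
    and "primitive_root_of_unity 5 \<zeta>"
    and "r ^ 2 = theta1 i \<zeta> * b"
    and "s ^ 2 = (theta1 i \<zeta> + 1) * b * r"
  shows "division_field K b 0 5 = adjoin K {\<zeta>, i, s}"
proof -
  note i = assms(5) and r = assms(7) and s = assms(8)
  define th where "th = theta1 i \<zeta>"
  have "\<zeta> ^ 5 = 1" "\<zeta> ^ 1 \<noteq> 1"
    using assms(6) unfolding primitive_root_of_unity_def by auto
  have "(\<zeta> - 1) * (\<zeta> ^ 4 + \<zeta> ^ 3 + \<zeta> ^ 2 + \<zeta> + 1) = 0"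
    using \<open>\<zeta> ^ 5 = 1\<close> by Groebner_Basis.algebra
  then have z: "\<zeta> ^ 4 + \<zeta> ^ 3 + \<zeta> ^ 2 + \<zeta> + 1 = 0" using \<open>\<zeta> ^ 1 \<noteq> 1\<close> by simp
  have q: "psi5_quartic 1 th = 0"
    using psi5_quartic_theta1[OF i z, of 1] by (simp add: th_def)
  \<comment> \<open>For \<open>b = 1\<close> the quartic takes the value 1 at 0 and 16 at
    -1.\<close>
  have "th \<noteq> 0" using q by (auto simp: psi5_quartic_def)
  moreover have "th + 1 \<noteq> 0" using q by (auto simp: psi5_quartic_def eq_neg_iff_add_eq_0[symmetric])
  ultimately have nz: "r \<noteq> 0" "s \<noteq> 0" "th + 1 \<noteq> 0"
    using r s \<open>b \<noteq> 0\<close> by (auto simp flip: th_def)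
  let ?T = "\<Union>P\<in>ec_torsion b 0 5. coordinates P"
  have "?T \<subseteq> adjoin K {\<zeta>, i, s}"
  proof
    fix w assume "w \<in> ?T"
    then obtain P where "P \<in> ec_torsion b 0 5" and wP: "w \<in> coordinates P" by blast
    moreover obtain x y where Pxy: "P = Affine x y" using wP by (cases P) auto
    ultimately have P: "on_curve b 0 (Affine x y)" "ec_mult b 5 (Affine x y) = Infinity"
      and w: "w = x \<or> w = y"
      unfolding ec_torsion_def by auto
    obtain u v where uv: "(u, v) \<in> torsion_scalings i \<zeta>" "x \<in> {u * r, - (u * r)}"
      "y \<in> {v * s, - (v * s), i * v * s, - (i * v * s)}"
      using torsion_coordinates[OF i z r s P] .
    have gens: "\<zeta> \<in> adjoin K {\<zeta>, i, s}" "i \<in> adjoin K {\<zeta>, i, s}"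
      "s \<in> adjoin K {\<zeta>, i, s}" "b \<in> adjoin K {\<zeta>, i, s}"
      using \<open>b \<in> K\<close> by (auto intro: adjoin_gen adjoin_base)
    have uvF: "u \<in> adjoin K {\<zeta>, i, s}" "v \<in> adjoin K {\<zeta>, i, s}"
      using torsion_scalings_closed[OF uv(1) gens(2,1)] by auto
    \<comment> \<open>The inner square root is recovered from the outer one, so it is absent from
      the generators.\<close>
    have "r = s ^ 2 / ((th + 1) * b)" using s nz \<open>b \<noteq> 0\<close> by (simp flip: th_def)
    moreover have "th \<in> adjoin K {\<zeta>, i, s}"
      unfolding th_def theta1_def using gens by (intro adjoin_closed(1,2,5-))
    ultimately have "r \<in> adjoin K {\<zeta>, i, s}"
      using gens by (auto intro!: adjoin_closed(1,2,5-))
    with gens uvF uv w show "w \<in> adjoin K {\<zeta>, i, s}"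
      by (auto intro!: adjoin_uminus adjoin_mult)
  qed
  moreover have "{\<zeta>, i, s} \<subseteq> adjoin K ?T"
  proof -
    have P: "on_curve b 0 (Affine r s)"
      using r s by (simp add: power3_eq_cube power2_eq_square algebra_simps)
    have iP: "on_curve b 0 (Affine (- r) (i * s))"
      unfolding on_curve.simps using P i unfolding on_curve.simps by Groebner_Basis.algebra
    have "psi5_quartic b (r ^ 2) = 0" unfolding r by (rule psi5_quartic_theta1[OF i z])
    then have "Affine r s \<in> ec_torsion b 0 5" "Affine (- r) (i * s) \<in> ec_torsion b 0 5"
      unfolding ec_torsion_def
      using P iP torsion_of_psi5_quartic[OF P] torsion_of_psi5_quartic[OF iP] \<open>b \<noteq> 0\<close> by auto
    then have "r \<in> ?T" "s \<in> ?T" "i * s \<in> ?T" by force+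
    then have mem: "r \<in> adjoin K ?T" "s \<in> adjoin K ?T" "i * s \<in> adjoin K ?T"
      by (auto intro: adjoin_gen)
    have "i * s / s \<in> adjoin K ?T" using mem by (intro adjoin_divide)
    then have "i \<in> adjoin K ?T" using nz by simp
    moreover have "th \<in> adjoin K ?T"
    proof -
      have "th = r ^ 2 / b" using r \<open>b \<noteq> 0\<close> by (simp flip: th_def)
      then show ?thesis using mem \<open>b \<in> K\<close> by (auto intro: adjoin_closed)
    qed
    ultimately have "\<zeta> \<in> adjoin K ?T"
      by (subst zeta_eq_theta1[OF i z th_def]) (intro adjoin_closed(1,2,5-))
    then show ?thesis using mem \<open>i \<in> adjoin K ?T\<close> by auto
  qed
  ultimately show ?thesis
    unfolding division_field_def by (intro subset_antisym adjoin_subset)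
qed

end
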